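(* Let $D\subset\mathbb{C}$ be a convex domain, let $f=h+\overline{g}$ be a complex-valued harmonic function on $D$ (with $h,g$ analytic on $D$), and let $\Omega=f(D)$. Then $f$ is univalent in $D$ if and only if there exists a complex-valued function $\phi=\phi(w,\overline{w})$ in $C^1(\Omega)$ such that for every $\epsilon\in\mathbb{C}$ with $|\epsilon|=1$ there exists a real number $\gamma=\gamma(\epsilon)$ satisfying $$\operatorname{Re}\left\{e^{i\gamma}\left(\partial\phi(f(z),\overline{f(z)})+\epsilon\,\overline{\partial}\phi(f(z),\overline{f(z)})\right)\right\}>0\quad\text{for all } z\in D,$$ where $\partial=\frac{\partial}{\partial z}$ and $\overline{\partial}=\frac{\partial}{\partial\overline{z}}$ are applied to the composed function $z\mapsto\phi(f(z),\overline{f(z)})$ on $D$.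
   Context: A domain is a nonempty open connected subset of $\mathbb{C}$; univalent means injective. A complex-valued function $f$ is harmonic on a simply connected domain $D$ if its real and imaginary parts satisfy the Laplace equation; equivalently $f=h+\overline{g}$ with $h,g$ analytic on $D$. $C^1(\Omega)$ denotes the complex-valued functions on $\Omega$ that are continuously differentiable in the real sense (if $\Omega$ is not open: that extend to such a function on an open neighbourhood of $\Omega$). The notation $\phi(w,\overline{w})$ only indicates that $\phi$ is a function of $w\in\Omega$ that need not be analytic. For $\Psi(z)=\phi(f(z),\overline{f(z)})$, $z=x+iy\in D$, the symbols $\partial\phi(f(z),\overline{f(z)})$ and $\overline{\partial}\phi(f(z),\overline{f(z)})$ mean $\Psi_z=\frac12(\Psi_x-i\Psi_y)$ and $\Psi_{\overline z}=\frac12(\Psi_x+i\Psi_y)$ at $z$. The number $\gamma$ may depend on $\epsilon$ but not on $z$. *)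

theory Defs
  imports "HOL-Complex_Analysis.Complex_Analysis"
begin

definition partial_x :: "(complex \<Rightarrow> 'a::real_normed_vector) \<Rightarrow> complex \<Rightarrow> 'a" where
  "partial_x F z = vector_derivative (\<lambda>t. F (Complex t (Im z))) (at (Re z))"

definition partial_y :: "(complex \<Rightarrow> 'a::real_normed_vector) \<Rightarrow> complex \<Rightarrow> 'a" where
  "partial_y F z = vector_derivative (\<lambda>t. F (Complex (Re z) t)) (at (Im z))"

definition wirtinger :: "(complex \<Rightarrow> complex) \<Rightarrow> complex \<Rightarrow> complex" where
  "wirtinger F z = (partial_x F z - \<i> * partial_y F z) / 2"

definition wirtinger_bar :: "(complex \<Rightarrow> complex) \<Rightarrow> complex \<Rightarrow> complex" where
  "wirtinger_bar F z = (partial_x F z + \<i> * partial_y F z) / 2"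

(* Continuously differentiable in the real sense; only meant for open U. *)
definition C1_open :: "complex set \<Rightarrow> (complex \<Rightarrow> 'a::real_normed_vector) \<Rightarrow> bool" where
  "C1_open U F \<longleftrightarrow> (\<forall>z\<in>U. F differentiable (at z)) \<and>
     continuous_on U (partial_x F) \<and> continuous_on U (partial_y F)"

(* S need not be open. For open S this is C1_open S F, see C1_on_open_iff below. *)
definition C1_on :: "complex set \<Rightarrow> (complex \<Rightarrow> 'a::real_normed_vector) \<Rightarrow> bool" where
  "C1_on S F \<longleftrightarrow> (\<exists>U G. open U \<and> S \<subseteq> U \<and> C1_open U G \<and> (\<forall>w\<in>S. G w = F w))"

(* Only meant for open D. *)
definition real_harmonic_on :: "(complex \<Rightarrow> real) \<Rightarrow> complex set \<Rightarrow> bool" where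
  "real_harmonic_on u D \<longleftrightarrow>
     C1_open D u \<and> C1_open D (partial_x u) \<and> C1_open D (partial_y u) \<and>
     (\<forall>z\<in>D. partial_x (partial_x u) z + partial_y (partial_y u) z = 0)"

definition harmonic_on :: "(complex \<Rightarrow> complex) \<Rightarrow> complex set \<Rightarrow> bool" where
  "harmonic_on f D \<longleftrightarrow>
     real_harmonic_on (\<lambda>z. Re (f z)) D \<and> real_harmonic_on (\<lambda>z. Im (f z)) D"


lemma partials_of_has_derivative:
  assumes "(F has_derivative F') (at z)"
  shows "partial_x F z = F' 1" "partial_y F z = F' \<i>"
proof -
  have z: "Complex (Re z) (Im z) = z" by simp
  have lin: "linear F'" using assms has_derivative_linear by blast
  have "((\<lambda>t. Complex t (Im z)) has_derivative (\<lambda>t. t *\<^sub>R 1)) (at (Re z))"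
    unfolding Complex_eq by (auto intro!: derivative_eq_intros simp: scaleR_conv_of_real)
  from has_derivative_compose[OF this, of F F'] assms
  have "((\<lambda>t. F (Complex t (Im z))) has_derivative (\<lambda>t. F' (t *\<^sub>R 1))) (at (Re z))"
    by (simp add: z)
  then show "partial_x F z = F' 1"
    unfolding partial_x_def
    by (intro vector_derivative_at) (simp add: has_vector_derivative_def linear_cmul[OF lin])
  have "((\<lambda>t. Complex (Re z) t) has_derivative (\<lambda>t. t *\<^sub>R \<i>)) (at (Im z))"
    unfolding Complex_eq by (auto intro!: derivative_eq_intros simp: scaleR_conv_of_real)
  from has_derivative_compose[OF this, of F F'] assms
  have "((\<lambda>t. F (Complex (Re z) t)) has_derivative (\<lambda>t. F' (t *\<^sub>R \<i>))) (at (Im z))"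
    by (simp add: z)
  then show "partial_y F z = F' \<i>"
    unfolding partial_y_def
    by (intro vector_derivative_at) (simp add: has_vector_derivative_def linear_cmul[OF lin])
qed

lemma C1_open_cong:
  assumes "open U" "C1_open U F" "\<And>w. w \<in> U \<Longrightarrow> F w = G w"
  shows "C1_open U G"
proof -
  have *: "G differentiable (at z)" "partial_x F z = partial_x G z" "partial_y F z = partial_y G z"
    if z: "z \<in> U" for z
  proof -
    obtain F' where F': "(F has_derivative F') (at z)"
      using assms(2) z unfolding C1_open_def differentiable_def by blast
    have G': "(G has_derivative F') (at z)"
      using has_derivative_transform_within_open[OF F' assms(1) z] assms(3) by blast
    then show "G differentiable (at z)" unfolding differentiable_def by blast
    show "partial_x F z = partial_x G z" "partial_y F z = partial_y G z"
      using partials_of_has_derivative[OF F'] partials_of_has_derivative[OF G'] by simp_all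
  qed
  have "continuous_on U (partial_x G)" "continuous_on U (partial_y G)"
    using assms(2) * unfolding C1_open_def by (auto cong: continuous_on_cong_simp)
  with *(1) show ?thesis unfolding C1_open_def by blast
qed

lemma C1_open_subset: "C1_open U F \<Longrightarrow> S \<subseteq> U \<Longrightarrow> C1_open S F"
  unfolding C1_open_def by (meson continuous_on_subset subsetD)

lemma C1_on_open_iff:
  assumes "open S"
  shows "C1_on S F \<longleftrightarrow> C1_open S F"
proof
  assume "C1_on S F"
  then obtain U G where "S \<subseteq> U" "C1_open U G" "\<forall>w\<in>S. G w = F w"
    unfolding C1_on_def by blast
  then show "C1_open S F"
    using C1_open_cong[OF assms, of G F] C1_open_subset by blast
next
  assume "C1_open S F"
  then show "C1_on S F" unfolding C1_on_def using assms by blast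
qed

lemma C1_open_Re_holomorphic:
  assumes "open D" "p holomorphic_on D" "\<And>w. w \<in> D \<Longrightarrow> u w = Re (p w)"
  shows "C1_open D u" and "\<And>z. z \<in> D \<Longrightarrow> partial_x u z = Re (deriv p z)"
    and "\<And>z. z \<in> D \<Longrightarrow> partial_y u z = Re (\<i> * deriv p z)"
proof -
  have u': "(u has_derivative (\<lambda>w. Re (deriv p z * w))) (at z)" if z: "z \<in> D" for z
  proof -
    have "(p has_derivative (*) (deriv p z)) (at z)"
      using holomorphic_derivI[OF assms(2,1) z] by (simp add: has_field_derivative_def)
    then have "((\<lambda>w. Re (p w)) has_derivative (\<lambda>w. Re (deriv p z * w))) (at z)"
      by (rule has_derivative_Re)
    from has_derivative_transform_within_open[OF this assms(1) z] assms(3) show ?thesis by simp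
  qed
  show x: "partial_x u z = Re (deriv p z)" if "z \<in> D" for z
    using partials_of_has_derivative(1)[OF u'[OF that]] by simp
  show y: "partial_y u z = Re (\<i> * deriv p z)" if "z \<in> D" for z
    using partials_of_has_derivative(2)[OF u'[OF that]] by (simp add: mult.commute)
  have c: "continuous_on D (deriv p)"
    using holomorphic_deriv[OF assms(2,1)] holomorphic_on_imp_continuous_on by blast
  have "continuous_on D (partial_x u)"
    using continuous_on_Re[OF c] x by (simp cong: continuous_on_cong_simp)
  moreover have "continuous_on D (partial_y u)"
  proof (subst continuous_on_cong[OF refl y])
    show "continuous_on D (\<lambda>z. Re (\<i> * deriv p z))" by (intro continuous_intros c)
  qed simp_all
  ultimately show "C1_open D u"
    unfolding C1_open_def differentiable_def using u' by blast
qed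

lemma real_harmonic_on_Re:
  assumes "open D" "p holomorphic_on D" "\<And>w. w \<in> D \<Longrightarrow> u w = Re (p w)"
  shows "real_harmonic_on u D"
proof -
  note 1 = C1_open_Re_holomorphic[OF assms]
  have p': "deriv p holomorphic_on D" using assms by (intro holomorphic_deriv)
  note 2 = C1_open_Re_holomorphic[OF assms(1) p' 1(2)]
  have q: "(\<lambda>z. \<i> * deriv p z) holomorphic_on D" by (intro holomorphic_intros p')
  note 3 = C1_open_Re_holomorphic[OF assms(1) q 1(3)]
  have "deriv (\<lambda>z. \<i> * deriv p z) z = \<i> * deriv (deriv p) z" if "z \<in> D" for z
    using p' assms(1) that by (intro deriv_cmult) (auto simp: holomorphic_on_open field_differentiable_def)
  with 1 2 3 show ?thesis unfolding real_harmonic_on_def by simp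
qed

lemma harmonic_on_holomorphic_plus_cnj:
  assumes "open D" "h holomorphic_on D" "g holomorphic_on D"
    and "\<And>z. z \<in> D \<Longrightarrow> f z = h z + cnj (g z)"
  shows "harmonic_on f D"
proof -
  have "(\<lambda>z. h z + g z) holomorphic_on D" "(\<lambda>z. - \<i> * (h z - g z)) holomorphic_on D"
    by (intro holomorphic_intros assms)+
  then show ?thesis unfolding harmonic_on_def
    using real_harmonic_on_Re[OF assms(1)] assms(4) by auto
qed

end

theory Submission
  imports Defs
begin

text \<open>
  The condition says that, for each direction separately, the directional derivative of
  \<open>\<Psi> = \<phi> \<circ> f\<close> divided by the direction stays in one open half-plane with \<open>0\<close> on its boundary:
  if \<open>p\<close> and \<open>q\<close> are the two Wirtinger derivatives of \<open>\<Psi>\<close>, the derivative along \<open>v \<noteq> 0\<close> is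
  \<open>p v + q cnj v\<close>, which is \<open>v\<close> times the sum \<open>p + \<epsilon> q\<close> with \<open>\<epsilon> = cnj v / v\<close>, and every
  unimodular \<open>\<epsilon>\<close> arises so. If the
  condition holds, then, as in the Noshiro--Warschawski theorem, a suitable real linear functional
  of \<open>\<Psi>\<close> increases strictly along the segment between two points of the convex set \<open>D\<close>, so
  \<open>\<Psi>\<close>, and with it \<open>f\<close>, is injective
  (\<open>inj_on_if_rotated_wirtinger_sum_Re_pos\<close>).

  Conversely, if \<open>f\<close> is injective then \<open>\<phi> = f\<^sup>-\<^sup>1\<close> gives \<open>\<Psi> = id\<close>, whose Wirtinger
  derivatives are \<open>1\<close> and \<open>0\<close>, so that \<open>\<gamma> = 0\<close> works for every \<open>\<epsilon>\<close>. What has to be shown is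
  that this inverse is continuously differentiable, that is, that the Jacobian
  \<open>|h'|\<^sup>2 - |g'|\<^sup>2\<close> has no zero. This is Lewy's theorem
  (\<open>Lewy_harmonic_Jacobian_nonzero\<close>). If the Jacobian vanishes at \<open>z0\<close>, then after rotating \<open>f\<close>
  its real part is the real part of a holomorphic \<open>F\<close> with \<open>F' z0 = 0\<close>. In a local coordinate
  \<open>F\<close> is \<open>F z0 + w ^ n\<close> with \<open>n \<ge> 2\<close> (or constant), so at least four arcs of the level set of
  \<open>Re F\<close> start at \<open>z0\<close>. On their union the imaginary part of \<open>f\<close> must be injective. But an
  injective continuous function sends each arc to one side of its value at \<open>z0\<close>; among any three
  arcs, two go to the same side, and there they share a value by the intermediate value theorem.
\<close>

section \<open>Injectivity from directional derivatives in a half-plane\<close>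

lemma has_derivative_wirtinger:
  assumes "(F has_derivative F') (at z)"
  shows "F' v = wirtinger F z * v + wirtinger_bar F z * cnj v"
proof -
  interpret F': bounded_linear F'
    using assms by (rule has_derivative_bounded_linear)
  have "v = Re v *\<^sub>R 1 + Im v *\<^sub>R \<i>"
    by (simp add: complex_eq_iff)
  then have "F' v = Re v *\<^sub>R F' 1 + Im v *\<^sub>R F' \<i>"
    by (metis F'.add F'.scaleR)
  moreover have "F' 1 = wirtinger F z + wirtinger_bar F z"
      "F' \<i> = \<i> * (wirtinger F z - wirtinger_bar F z)"
    by (simp_all add: wirtinger_def wirtinger_bar_def
        partials_of_has_derivative[OF assms] field_simps)
  ultimately show ?thesis
    by (simp add: complex_eq_iff algebra_simps)
qed

text \<open>
  The Noshiro--Warschawski theorem for real differentiable functions. The rotation may depend on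
  \<open>\<epsilon>\<close> because along the segment from \<open>a\<close> to \<open>b\<close> only \<open>\<epsilon> = cnj (b - a) / (b - a)\<close> occurs: for
  this one value the real part of \<open>F\<close>, suitably rotated, is strictly increasing on the segment.
\<close>
lemma inj_on_if_rotated_wirtinger_sum_Re_pos:
  assumes "convex D"
    and F': "\<And>z. z \<in> D \<Longrightarrow> (F has_derivative F' z) (at z)"
    and pos: "\<And>\<epsilon>. cmod \<epsilon> = 1 \<Longrightarrow>
      \<exists>\<gamma>::real. \<forall>z\<in>D. Re (exp (\<i> * of_real \<gamma>) * (wirtinger F z + \<epsilon> * wirtinger_bar F z)) > 0"
  shows "inj_on F D"
proof (rule inj_onI, rule ccontr)
  fix a b assume ab: "a \<in> D" "b \<in> D" "F a = F b" "a \<noteq> b"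
  define v where "v = b - a"
  have "v \<noteq> 0" using ab by (simp add: v_def)
  then have "cmod (cnj v / v) = 1" by (simp add: norm_divide)
  from pos[OF this] obtain \<gamma> :: real where \<gamma>: "\<And>z. z \<in> D \<Longrightarrow>
      Re (exp (\<i> * of_real \<gamma>) * (wirtinger F z + cnj v / v * wirtinger_bar F z)) > 0"
    by blast
  \<comment> \<open>Dividing by \<open>v\<close> turns the derivative along \<open>v\<close> into exactly the sum in the hypothesis.\<close>
  define c where "c = exp (\<i> * of_real \<gamma>) / v"
  define k where "k t = Re (c * F (a + t *\<^sub>R v))" for t :: real
  have "k 0 < k 1"
  proof (rule DERIV_pos_imp_increasing[where f = k])
    fix t :: real assume t: "0 \<le> t" "t \<le> 1"
    define z where "z = a + t *\<^sub>R v"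
    have "z = (1 - t) *\<^sub>R a + t *\<^sub>R b"
      by (simp add: z_def v_def algebra_simps)
    then have "z \<in> D" using assms(1) ab t by (simp add: convex_def)
    have "((\<lambda>t. a + t *\<^sub>R v) has_derivative (\<lambda>s. s *\<^sub>R v)) (at t)"
      by (auto intro!: derivative_eq_intros)
    then have "((\<lambda>t. F (a + t *\<^sub>R v)) has_derivative (\<lambda>s. F' z (s *\<^sub>R v))) (at t)"
      using has_derivative_compose F'[OF \<open>z \<in> D\<close>] unfolding z_def by blast
    then have "(k has_derivative (\<lambda>s. Re (c * F' z (s *\<^sub>R v)))) (at t)"
      unfolding k_def by (intro has_derivative_Re has_derivative_mult_right)
    moreover have "(\<lambda>s. Re (c * F' z (s *\<^sub>R v))) = (*) (Re (c * F' z v))"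
      by (simp add: linear_scale[OF has_derivative_linear[OF F'[OF \<open>z \<in> D\<close>]]] fun_eq_iff)
    ultimately have "(k has_real_derivative Re (c * F' z v)) (at t)"
      by (simp add: has_field_derivative_def)
    moreover have "c * F' z v =
        exp (\<i> * of_real \<gamma>) * (wirtinger F z + cnj v / v * wirtinger_bar F z)"
      using \<open>v \<noteq> 0\<close> unfolding c_def has_derivative_wirtinger[OF F'[OF \<open>z \<in> D\<close>]]
      by (simp add: field_simps)
    ultimately show "\<exists>y. (k has_real_derivative y) (at t) \<and> y > 0"
      using \<gamma>[OF \<open>z \<in> D\<close>] by metis
  qed simp
  then show False
    using ab by (simp add: k_def v_def)
qed

section \<open>Level curves through a critical point\<close>

text \<open>
  The local coordinate is the inverse \<open>G\<close> of an \<open>n\<close>-th root of \<open>F - F z0\<close>, where \<open>n\<close> is the order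
  of the zero. The factor \<open>c\<close> is \<open>1\<close>, except that \<open>c = 0\<close> covers the case of \<open>F\<close> constant near
  \<open>z0\<close>; there any exponent would do, and \<open>2\<close> lets both cases be used alike.
\<close>
lemma holomorphic_critical_point_normal_form:
  assumes "open D" "F holomorphic_on D" "z0 \<in> D" "deriv F z0 = 0"
  obtains n \<delta> G c where "n \<ge> 2" "\<delta> > 0" "G ` ball 0 \<delta> \<subseteq> D"
    "continuous_on (ball 0 \<delta>) G" "inj_on G (ball 0 \<delta>)" "G 0 = z0"
    "\<And>w. w \<in> ball 0 \<delta> \<Longrightarrow> F (G w) = F z0 + of_real c * w ^ n"
proof -
  obtain R where R: "R > 0" "ball z0 R \<subseteq> D"
    using assms(1,3) open_contains_ball by blast
  have hol: "F holomorphic_on ball z0 R"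
    using assms(2) R(2) holomorphic_on_subset by blast
  show thesis
  proof (cases "\<forall>n>0. (deriv ^^ n) F z0 = 0")
    case True
    then have "F w = F z0" if "w \<in> ball z0 R" for w
      using holomorphic_fun_eq_const_on_connected[OF hol, of z0 w] R(1) that by simp
    then have const: "F (z0 + w) = F z0" if "w \<in> ball 0 R" for w
      using that by (simp add: dist_norm)
    show thesis
    proof (rule that[of 2 R "\<lambda>w. z0 + w" 0])
      show "(\<lambda>w. z0 + w) ` ball 0 R \<subseteq> D"
        using R(2) by (simp add: image_subset_iff subset_iff dist_norm)
      show "continuous_on (ball 0 R) (\<lambda>w. z0 + w)"
        by (intro continuous_intros)
    qed (use R(1) const in \<open>simp_all add: inj_on_def\<close>)
  next
    case False
    define n where "n = (LEAST n. n > 0 \<and> (deriv ^^ n) F z0 \<noteq> 0)"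
    have n: "n > 0" "(deriv ^^ n) F z0 \<noteq> 0"
      using False LeastI_ex[of "\<lambda>n. n > 0 \<and> (deriv ^^ n) F z0 \<noteq> 0"] unfolding n_def by auto
    have below: "(deriv ^^ i) F z0 = 0" if "0 < i" "i < n" for i
      using not_less_Least[of i "\<lambda>n. n > 0 \<and> (deriv ^^ n) F z0 \<noteq> 0"] that unfolding n_def by auto
    have "n \<noteq> 1" using n(2) assms(4) by auto
    with n(1) have "n \<ge> 2" by simp
    obtain g r where r: "r > 0" and g: "g holomorphic_on ball z0 r"
      and factor: "\<And>w. w \<in> ball z0 r \<Longrightarrow> F w - F z0 = ((w - z0) * g w) ^ n"
      and nz: "\<And>w. w \<in> ball z0 r \<Longrightarrow> g w \<noteq> 0"
      using holomorphic_factor_order_of_zero_strong[OF hol open_ball _ n below] R(1)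
      by (metis centre_in_ball)
    define \<psi> where "\<psi> w = (w - z0) * g w" for w
    define s where "s = min r R"
    have s: "s > 0" "ball z0 s \<subseteq> ball z0 r" "ball z0 s \<subseteq> D"
      using r R by (auto simp: s_def)
    have \<psi>: "\<psi> holomorphic_on ball z0 s"
      unfolding \<psi>_def using g s(2) by (intro holomorphic_intros) (auto intro: holomorphic_on_subset)
    have "(g has_field_derivative deriv g z0) (at z0)"
      using holomorphic_derivI[OF g open_ball] r by simp
    then have "(\<psi> has_field_derivative g z0) (at z0)"
      unfolding \<psi>_def by (auto intro!: derivative_eq_intros)
    then have "deriv \<psi> z0 \<noteq> 0"
      using nz r by (simp add: DERIV_imp_deriv)
    from has_complex_derivative_locally_invertible[OF \<psi> _ open_ball this] s(1)
    obtain q where q: "q > 0" "ball z0 q \<subseteq> ball z0 s" "open (\<psi> ` ball z0 q)" "inj_on \<psi> (ball z0 q)"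
      by (metis centre_in_ball)
    have "continuous_on (ball z0 q) \<psi>"
      using \<psi> q(2) holomorphic_on_imp_continuous_on holomorphic_on_subset by blast
    from invariance_of_domain_homeomorphism[OF open_ball this _ q(4)]
    obtain G where G: "homeomorphism (ball z0 q) (\<psi> ` ball z0 q) \<psi> G"
      by auto
    have "0 \<in> \<psi> ` ball z0 q"
      using q(1) by (auto simp: \<psi>_def intro!: image_eqI[of _ _ z0])
    with q(3) obtain \<delta> where \<delta>: "\<delta> > 0" "ball 0 \<delta> \<subseteq> \<psi> ` ball z0 q"
      using open_contains_ball by blast
    have G_in: "G w \<in> ball z0 q" "\<psi> (G w) = w" if "w \<in> ball 0 \<delta>" for w
    proof -
      from that \<delta>(2) have "w \<in> \<psi> ` ball z0 q" by (rule rev_subsetD)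
      then obtain u where "u \<in> ball z0 q" "w = \<psi> u" by (rule imageE)
      then show "G w \<in> ball z0 q" "\<psi> (G w) = w"
        using homeomorphism_apply1[OF G] by simp_all
    qed
    show thesis
    proof (rule that[of n \<delta> G 1])
      show "G ` ball 0 \<delta> \<subseteq> D" using G_in q(2) s(3) by blast
      show "continuous_on (ball 0 \<delta>) G"
        using continuous_on_subset[OF homeomorphism_cont2[OF G] \<delta>(2)] .
      show "inj_on G (ball 0 \<delta>)" using G_in(2) by (metis inj_onI)
      show "G 0 = z0"
        using homeomorphism_apply1[OF G, of z0] q(1) by (simp add: \<psi>_def)
      fix w :: complex assume "w \<in> ball 0 \<delta>"
      then show "F (G w) = F z0 + of_real 1 * w ^ n"
        using factor[of "G w"] G_in[of w] q(2) s(2) unfolding \<psi>_def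
        by (metis add.commute diff_add_cancel mult_1 of_real_1 subset_iff)
    qed fact+
  qed
qed

text \<open>
  Both paths reach the smaller of the two end values, and do so after time \<open>0\<close>.
\<close>
lemma common_value_of_rising_paths:
  fixes p q :: "real \<Rightarrow> real"
  assumes "s > 0" "continuous_on {0..s} p" "continuous_on {0..s} q"
    and "p 0 = q 0" "p 0 < p s" "q 0 < q s"
  obtains t u where "0 < t" "t \<le> s" "0 < u" "u \<le> s" "p t = q u"
proof -
  define m where "m = min (p s) (q s)"
  have m: "p 0 < m" "q 0 < m" "m \<le> p s" "m \<le> q s"
    using assms by (auto simp: m_def)
  obtain t where t: "0 \<le> t" "t \<le> s" "p t = m"
    using IVT'[of p 0 m s] m assms(1,2) by auto
  obtain u where u: "0 \<le> u" "u \<le> s" "q u = m"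
    using IVT'[of q 0 m s] m assms(1,3) by auto
  show thesis
    using that[of t u] t u m by (metis order_le_less less_irrefl)
qed

text \<open>
  The topological core of Lewy's theorem. At a critical point of \<open>F\<close> the level set of \<open>Re F\<close> contains three arcs that meet only in \<open>z0\<close>, and a
  continuous real function cannot be injective on such a tripod.
\<close>
lemma deriv_nonzero_if_inj_with_Re_holomorphic:
  fixes v :: "complex \<Rightarrow> real"
  assumes "open D" "F holomorphic_on D" "continuous_on D v"
    and inj: "inj_on (\<lambda>z. (Re (F z), v z)) D" and "z0 \<in> D"
  shows "deriv F z0 \<noteq> 0"
proof
  assume "deriv F z0 = 0"
  from holomorphic_critical_point_normal_form[OF assms(1,2,5) this]
  obtain n c \<delta> G where n: "n \<ge> 2" and \<delta>: "\<delta> > 0" and GD: "G ` ball 0 \<delta> \<subseteq> D"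
    and Gc: "continuous_on (ball 0 \<delta>) G" and Gi: "inj_on G (ball 0 \<delta>)" and G0: "G 0 = z0"
    and FG: "\<And>w. w \<in> ball 0 \<delta> \<Longrightarrow> F (G w) = F z0 + of_real c * w ^ n"
    by metis
  \<comment> \<open>Directions in which \<open>w ^ n\<close> is purely imaginary. The angles for \<open>k = 0, 1, 2\<close> lie between
    \<open>- pi / 4\<close> and \<open>3 * pi / 4\<close> since \<open>n \<ge> 2\<close>, so they are principal arguments and the three
    directions differ.\<close>
  define \<omega> where "\<omega> k = cis (pi * ((2 * real k - 1) / (2 * real n)))" for k :: nat
  define s where "s = \<delta> / 2"
  have s: "s > 0" "s < \<delta>" using \<delta> by (auto simp: s_def)
  have ray: "of_real t * \<omega> k \<in> ball 0 \<delta>" if "0 \<le> t" "t \<le> s" for t k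
    using that s by (simp add: \<omega>_def norm_mult)
  have \<omega>_inj: "i = j" if "\<omega> i = \<omega> j" "i < 3" "j < 3" for i j
  proof -
    have Arg_\<omega>: "Arg (\<omega> k) = pi * ((2 * real k - 1) / (2 * real n))" if "k < 3" for k
    proof -
      have "- 1 < (2 * real k - 1) / (2 * real n)" "(2 * real k - 1) / (2 * real n) \<le> 1"
        using that n by (auto simp: field_simps)
      then have "pi * (- 1) < pi * ((2 * real k - 1) / (2 * real n))"
          "pi * ((2 * real k - 1) / (2 * real n)) \<le> pi * 1"
        using pi_gt_zero by (intro mult_strict_left_mono mult_left_mono; simp)+
      then show ?thesis
        unfolding \<omega>_def by (intro Arg_cis) simp
    qed
    have "pi * ((2 * real i - 1) / (2 * real n)) = pi * ((2 * real j - 1) / (2 * real n))"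
      using that Arg_\<omega> by metis
    then show ?thesis using n by simp
  qed
  have level: "Re (F (G (of_real t * \<omega> k))) = Re (F z0)" if "0 \<le> t" "t \<le> s" for t k
  proof -
    have "real n * (pi * ((2 * real k - 1) / (2 * real n))) = real k * pi - pi / 2"
      using n by (simp add: field_simps)
    then have "\<omega> k ^ n = cis (real k * pi - pi / 2)"
      unfolding \<omega>_def Complex.DeMoivre by simp
    then have "Re (\<omega> k ^ n) = 0"
      by (simp add: cos_diff)
    moreover have "of_real c * (of_real t * \<omega> k) ^ n = of_real (c * t ^ n) * \<omega> k ^ n"
      by (simp add: power_mult_distrib)
    ultimately have "Re (of_real c * (of_real t * \<omega> k) ^ n) = 0"
      by (metis Re_complex_of_real Im_complex_of_real mult_zero_left mult_zero_right diff_zero times_complex.sel(1))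
    then show ?thesis using FG[OF ray[OF that]] by simp
  qed
  define p where "p k t = v (G (of_real t * \<omega> k))" for k and t :: real
  have p_cont: "continuous_on {0..s} (p k)" for k
    unfolding p_def
    by (rule continuous_on_compose2[OF assms(3)], rule continuous_on_compose2[OF Gc])
      (use ray GD in \<open>auto intro!: continuous_intros\<close>)
  have same_ray: "i = j"
    if "p i t = p j u" "0 < t" "t \<le> s" "0 < u" "u \<le> s" "i < 3" "j < 3" for i j t u
  proof -
    have "G (of_real t * \<omega> i) = G (of_real u * \<omega> j)"
      using that ray GD level[of t i] level[of u j]
      by (intro inj_onD[OF inj]) (auto simp: p_def)
    then have eq: "of_real t * \<omega> i = of_real u * \<omega> j"
      by (rule inj_onD[OF Gi]) (use that ray in simp_all)
    then have "cmod (of_real t * \<omega> i) = cmod (of_real u * \<omega> j)" by simp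
    then have "t = u" using that by (simp add: norm_mult \<omega>_def)
    then show ?thesis using eq that \<omega>_inj by simp
  qed
  have p0: "p k 0 = v z0" for k by (simp add: p_def G0)
  have ne: "p k s \<noteq> v z0" if "k < 3" for k
  proof
    assume *: "p k s = v z0"
    have "G (of_real s * \<omega> k) = G 0"
      using * s ray[of s k] GD level[of s k] assms(5)
      by (intro inj_onD[OF inj]) (auto simp: p_def G0)
    then have "of_real s * \<omega> k = 0"
      by (rule inj_onD[OF Gi]) (use ray[of s k] s \<delta> in simp_all)
    then show False using s by (simp add: \<omega>_def)
  qed
  \<comment> \<open>Neither side of \<open>v z0\<close> can hold the ends of two different arcs, which leaves no room for
    three.\<close>
  have up: "i = j" if "p i s > v z0" "p j s > v z0" "i < 3" "j < 3" for i j
    using common_value_of_rising_paths[OF s(1) p_cont[of i] p_cont[of j]] that p0 same_ray by metis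
  have down: "i = j" if "p i s < v z0" "p j s < v z0" "i < 3" "j < 3" for i j
    using common_value_of_rising_paths[OF s(1), of "\<lambda>t. - p i t" "\<lambda>t. - p j t"]
      continuous_on_minus p_cont that p0 same_ray by (metis neg_equal_iff_equal neg_less_iff_less)
  show False
    using up[of 0 1] up[of 0 2] up[of 1 2] down[of 0 1] down[of 0 2] down[of 1 2]
      ne[of 0] ne[of 1] ne[of 2] by force
qed

section \<open>Injective harmonic maps are diffeomorphisms\<close>

text \<open>
  Lewy's theorem. The Jacobian of \<open>h + cnj g\<close> is \<open>|h'|\<^sup>2 - |g'|\<^sup>2\<close>. Where it vanishes, the
  derivative has rank at most one, so some real linear combination of the two coordinates, written
  as the real part of \<open>\<mu> (h + cnj g)\<close> with \<open>|\<mu>| = 1\<close>, has a critical point.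
\<close>
lemma Lewy_harmonic_Jacobian_nonzero:
  assumes "open D" "h holomorphic_on D" "g holomorphic_on D"
    and inj: "inj_on (\<lambda>z. h z + cnj (g z)) D" and "z \<in> D"
  shows "cmod (deriv h z) \<noteq> cmod (deriv g z)"
proof
  assume eq: "cmod (deriv h z) = cmod (deriv g z)"
  obtain \<mu> where \<mu>: "cmod \<mu> = 1" "\<mu>\<^sup>2 * deriv h z = - deriv g z"
  proof (cases "deriv h z = 0")
    case True
    then have "deriv g z = 0" using eq by simp
    with True show thesis by (intro that[of 1]) simp_all
  next
    case False
    define q where "q = - deriv g z / deriv h z"
    have "cmod q = 1" using False by (simp add: q_def norm_divide flip: eq)
    then have "cmod (csqrt q) = 1" by (simp add: norm_csqrt)
    then show thesis using that[of "csqrt q"] False by (simp add: q_def)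
  qed
  \<comment> \<open>Conjugating the second summand does not change real parts, and makes it holomorphic.\<close>
  define F where "F w = \<mu> * h w + cnj \<mu> * g w" for w
  define v where "v w = Im (\<mu> * (h w + cnj (g w)))" for w
  have hol: "F holomorphic_on D"
    unfolding F_def by (intro holomorphic_intros assms)
  have Re_F: "Re (F w) = Re (\<mu> * (h w + cnj (g w)))" for w
    by (simp add: F_def algebra_simps)
  have "continuous_on D v"
    unfolding v_def using assms by (intro continuous_intros holomorphic_on_imp_continuous_on)
  moreover have "inj_on (\<lambda>w. (Re (F w), v w)) D"
  proof (rule inj_onI)
    fix a b assume ab: "a \<in> D" "b \<in> D" "(Re (F a), v a) = (Re (F b), v b)"
    then have "\<mu> * (h a + cnj (g a)) = \<mu> * (h b + cnj (g b))"
      by (simp only: Re_F v_def prod.inject complex_eq_iff)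
    moreover have "\<mu> \<noteq> 0" using \<mu>(1) by auto
    ultimately have "h a + cnj (g a) = h b + cnj (g b)"
      by (simp only: mult_cancel_left) simp
    then show "a = b" using ab(1,2) by (rule inj_onD[OF inj])
  qed
  ultimately have "deriv F z \<noteq> 0"
    by (rule deriv_nonzero_if_inj_with_Re_holomorphic[OF assms(1) hol _ _ assms(5)])
  moreover have "(F has_field_derivative \<mu> * deriv h z + cnj \<mu> * deriv g z) (at z)"
    unfolding F_def
    by (intro DERIV_add DERIV_cmult holomorphic_derivI[of _ D] assms)
  moreover have "\<mu> * deriv h z + cnj \<mu> * deriv g z = 0"
  proof -
    have "cnj \<mu> * \<mu> = 1" using \<mu>(1) complex_norm_square[of \<mu>] by (simp add: mult.commute)
    then have "\<mu> * deriv h z = cnj \<mu> * (\<mu>\<^sup>2 * deriv h z)"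
      by (simp add: power2_eq_square mult.assoc[symmetric])
    then show ?thesis using \<mu>(2) by simp
  qed
  ultimately show False by (simp add: DERIV_imp_deriv)
qed

lemma has_derivative_holomorphic_plus_cnj:
  assumes "open D" "h holomorphic_on D" "g holomorphic_on D" "z \<in> D"
  shows "((\<lambda>z. h z + cnj (g z)) has_derivative (\<lambda>v. deriv h z * v + cnj (deriv g z * v))) (at z)"
  using holomorphic_derivI[OF assms(2,1,4)] holomorphic_derivI[OF assms(3,1,4)]
  unfolding has_field_derivative_def by (intro has_derivative_add has_derivative_cnj)

text \<open>
  By invariance of domain the inverse is a continuous map on an open set. Lewy's theorem makes each
  derivative of \<open>f\<close> invertible, and the explicit inverse matrix depends continuously on the point.
\<close>
lemma C1_open_inverse_harmonic:
  assumes D: "open D" and h: "h holomorphic_on D" and g: "g holomorphic_on D"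
    and f: "\<And>z. z \<in> D \<Longrightarrow> f z = h z + cnj (g z)" and inj: "inj_on f D"
  shows "open (f ` D)" "C1_open (f ` D) (inv_into D f)"
proof -
  have f': "(f has_derivative (\<lambda>v. deriv h z * v + cnj (deriv g z * v))) (at z)"
    if "z \<in> D" for z
    using has_derivative_transform_within_open[OF
        has_derivative_holomorphic_plus_cnj[OF D h g that] D that] f by simp
  have cont: "continuous_on D f"
    using f' by (meson continuous_at_imp_continuous_on has_derivative_continuous)
  show "open (f ` D)"
    using invariance_of_domain[OF cont D inj] .
  have inv_cont: "continuous_on (f ` D) (inv_into D f)"
    by (rule continuous_on_inverse_open[OF D cont]) (simp_all add: inj)
  define J where "J z = deriv h z * cnj (deriv h z) - deriv g z * cnj (deriv g z)" for z
  have J: "J z \<noteq> 0" if "z \<in> D" for z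
  proof
    assume "J z = 0"
    then have "of_real ((cmod (deriv h z))\<^sup>2) = (of_real ((cmod (deriv g z))\<^sup>2) :: complex)"
      by (simp add: J_def complex_norm_square del: of_real_power)
    then have "cmod (deriv h z) = cmod (deriv g z)"
      by (simp only: of_real_eq_iff power2_eq_iff_nonneg[OF norm_ge_zero norm_ge_zero])
    moreover have "inj_on (\<lambda>z. h z + cnj (g z)) D"
      using inj f by (simp cong: inj_on_cong)
    ultimately show False using Lewy_harmonic_Jacobian_nonzero[OF D h g _ that] by blast
  qed
  \<comment> \<open>The solution \<open>v\<close> of \<open>h' v + cnj (g' v) = w\<close>, by Cramer's rule applied to this equation and
    its conjugate.\<close>
  define L where "L z w = (cnj (deriv h z) * w - cnj (deriv g z) * cnj w) / J z" for z w
  have inv': "(inv_into D f has_derivative L (inv_into D f w)) (at w)" if "w \<in> f ` D" for w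
  proof -
    obtain z where z: "z \<in> D" "w = f z" using \<open>w \<in> f ` D\<close> by (rule imageE)
    have "(inv_into D f has_derivative L z) (at (f z))"
    proof (rule has_derivative_inverse_on[OF D f' inv_into_f_f[OF inj] _ z(1)])
      show "(\<lambda>v. deriv h z * v + cnj (deriv g z * v)) \<circ> L z = id"
      proof
        fix w
        have "cnj (J z) = J z" by (simp add: J_def mult.commute)
        then show "((\<lambda>v. deriv h z * v + cnj (deriv g z * v)) \<circ> L z) w = id w"
          using J[OF z(1)] unfolding L_def by (simp add: divide_simps) (simp add: J_def algebra_simps)
      qed
    qed
    then show ?thesis using z inj by simp
  qed
  have cont': "continuous_on D (deriv h)" "continuous_on D (deriv g)"
    using h g D holomorphic_deriv holomorphic_on_imp_continuous_on by blast+
  have "continuous_on D (\<lambda>z. L z w)" for w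
    unfolding L_def using J by (intro continuous_intros cont' ballI) (auto simp: J_def intro!: continuous_intros cont')
  then have L_cont: "continuous_on (f ` D) (\<lambda>w. L (inv_into D f w) u)" for u
    using inv_cont by (rule continuous_on_compose2) (auto intro: inv_into_into)
  show "C1_open (f ` D) (inv_into D f)"
    unfolding C1_open_def
  proof (intro conjI ballI)
    fix w assume "w \<in> f ` D"
    then show "inv_into D f differentiable (at w)"
      using inv' unfolding differentiable_def by blast
  next
    show "continuous_on (f ` D) (partial_x (inv_into D f))"
      using L_cont[of 1] partials_of_has_derivative(1)[OF inv'] by (simp cong: continuous_on_cong_simp)
    show "continuous_on (f ` D) (partial_y (inv_into D f))"
      using L_cont[of \<i>] partials_of_has_derivative(2)[OF inv'] by (simp cong: continuous_on_cong_simp)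
  qed
qed

theorem theorem1:
  fixes D :: "complex set" and f h g :: "complex \<Rightarrow> complex"
  assumes "open D" and "D \<noteq> {}" and "convex D"
    and "harmonic_on f D"
    and "h holomorphic_on D" and "g holomorphic_on D"
    and "\<And>z. z \<in> D \<Longrightarrow> f z = h z + cnj (g z)"
  shows "inj_on f D \<longleftrightarrow>
    (\<exists>\<phi> :: complex \<Rightarrow> complex. C1_on (f ` D) \<phi> \<and>
      (\<forall>\<epsilon> :: complex. cmod \<epsilon> = 1 \<longrightarrow>
        (\<exists>\<gamma> :: real. \<forall>z\<in>D.
          Re (exp (\<i> * of_real \<gamma>) *
            (wirtinger (\<lambda>z. \<phi> (f z)) z + \<epsilon> * wirtinger_bar (\<lambda>z. \<phi> (f z)) z)) > 0)))"
    (is "_ \<longleftrightarrow> (\<exists>\<phi>. C1_on (f ` D) \<phi> \<and> ?cond \<phi>)")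
proof
  assume inj: "inj_on f D"
  let ?\<phi> = "inv_into D f"
  have "C1_on (f ` D) ?\<phi>"
    using C1_open_inverse_harmonic[OF assms(1,5,6,7) inj] by (simp add: C1_on_open_iff)
  moreover have "wirtinger (\<lambda>z. ?\<phi> (f z)) z = 1" "wirtinger_bar (\<lambda>z. ?\<phi> (f z)) z = 0"
    if "z \<in> D" for z
  proof -
    have "((\<lambda>z. ?\<phi> (f z)) has_derivative (\<lambda>v. v)) (at z)"
      by (rule has_derivative_transform_within_open[OF has_derivative_ident assms(1) that])
        (simp add: inj)
    from partials_of_has_derivative[OF this]
    show "wirtinger (\<lambda>z. ?\<phi> (f z)) z = 1" "wirtinger_bar (\<lambda>z. ?\<phi> (f z)) z = 0"
      by (simp_all add: wirtinger_def wirtinger_bar_def)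
  qed
  then have "?cond ?\<phi>"
    by (auto intro!: exI[of _ "0::real"])
  ultimately show "\<exists>\<phi>. C1_on (f ` D) \<phi> \<and> ?cond \<phi>" by blast
next
  assume "\<exists>\<phi>. C1_on (f ` D) \<phi> \<and> ?cond \<phi>"
  then obtain \<phi> where C1: "C1_on (f ` D) \<phi>" and cond: "?cond \<phi>" by blast
  from C1 obtain U G where G: "f ` D \<subseteq> U" "C1_open U G" "\<And>w. w \<in> f ` D \<Longrightarrow> G w = \<phi> w"
    unfolding C1_on_def by blast
  have diff: "(\<lambda>z. \<phi> (f z)) differentiable (at z)" if "z \<in> D" for z
  proof -
    have "(f has_derivative (\<lambda>v. deriv h z * v + cnj (deriv g z * v))) (at z)"
      using has_derivative_transform_within_open[OF
          has_derivative_holomorphic_plus_cnj[OF assms(1,5,6) that] assms(1) that] assms(7) by simp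
    moreover have "f z \<in> U" using G(1) that by blast
    with G(2) have "G differentiable (at (f z))"
      unfolding C1_open_def by simp
    then obtain G' where "(G has_derivative G') (at (f z))"
      unfolding differentiable_def by (rule exE)
    ultimately have "((\<lambda>z. G (f z)) has_derivative
        (\<lambda>v. G' (deriv h z * v + cnj (deriv g z * v)))) (at z)"
      by (rule has_derivative_compose)
    then have "((\<lambda>z. \<phi> (f z)) has_derivative
        (\<lambda>v. G' (deriv h z * v + cnj (deriv g z * v)))) (at z)"
      by (rule has_derivative_transform_within_open[OF _ assms(1) that]) (simp add: G(3))
    then show ?thesis by (rule differentiableI)
  qed
  have "inj_on (\<lambda>z. \<phi> (f z)) D"
  proof (rule inj_on_if_rotated_wirtinger_sum_Re_pos[OF assms(3)])
    show "((\<lambda>z. \<phi> (f z)) has_derivative frechet_derivative (\<lambda>z. \<phi> (f z)) (at z)) (at z)"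
      if "z \<in> D" for z
      using diff[OF that] by (simp add: frechet_derivative_works)
  qed (use cond in simp)
  then show "inj_on f D" by (auto simp: inj_on_def)
qed

end
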